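(* Let $f:2^X\to\mathbb{R}_{\ge0}$ be monotone, normalized and $(\gamma,\beta)$-weakly submodular with $\gamma\in(0,1]$, $\beta\ge1$, and let $\phi=\gamma^2+\beta(1-\gamma)$. Let $\mathcal{M}=(X,\mathcal{I})$ be a matroid and $A,O$ bases of $\mathcal{M}$, indexed $A=\{a_1,\ldots,a_{|A|}\}$, $O=\{o_1,\ldots,o_{|A|}\}$ so that $A\setminus\{a_i\}\cup\{o_i\}\in\mathcal{I}$ for every $i$ (such an indexing exists by the matroid exchange property). Then $$\frac{\phi e^{\phi}}{e^{\phi}-1}f(A)\ge\gamma^2f(O)+\sum_{i=1}^{|A|}\left[g_\phi(A)-g_\phi(A\setminus\{a_i\}\cup\{o_i\})\right].$$
   Context: $f$ is monotone if $f(A)\le f(B)$ for $A\subseteq B$, normalized if $f(\emptyset)=0$; $f(e\mid A)=f(A\cup\{e\})-f(A)$. $f$ is $(\gamma,\beta)$-weakly submodular if for all $A\subseteq B\subseteq X$: $\gamma(f(B)-f(A))\le\sum_{e\in B\setminus A}f(e\mid A)$ and $\beta(f(B)-f(A))\ge\sum_{e\in B\setminus A}f(e\mid B\setminus\{e\})$. For $\phi>0$ and $0\le b\le a$, $m^{\phi}_{a,b}=\int_0^1\frac{\phi e^{\phi p}}{e^{\phi}-1}p^b(1-p)^{a-b}\,dp$, with $m^{\phi}_{a,b}=0$ if $a<0$ or $b<0$; the potential is $g_\phi(S)=\sum_{B\subseteq S}m^{\phi}_{|S|-1,|B|-1}f(B)$.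
   Formalization: The indexing is also required to satisfy o_i = a_i whenever o_i ∈ A (equivalently, each A∖{a_i}∪{o_i} is a base); without this the claim fails, e.g. A=O={x,y} in the free matroid, o_1=a_2, o_2=a_1, f = cardinality, γ=β=1. *)

theory Defs
  imports "HOL-Analysis.Analysis"
begin

definition monotone_setfun :: "'a set \<Rightarrow> ('a set \<Rightarrow> real) \<Rightarrow> bool" where
  "monotone_setfun X f \<longleftrightarrow> (\<forall>A B. A \<subseteq> B \<longrightarrow> B \<subseteq> X \<longrightarrow> f A \<le> f B)"

definition normalized_setfun :: "('a set \<Rightarrow> real) \<Rightarrow> bool" where
  "normalized_setfun f \<longleftrightarrow> f {} = 0"

definition marginal :: "('a set \<Rightarrow> real) \<Rightarrow> 'a \<Rightarrow> 'a set \<Rightarrow> real" where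
  "marginal f e A = f (A \<union> {e}) - f A"

definition weakly_submodular ::
    "real \<Rightarrow> real \<Rightarrow> 'a set \<Rightarrow> ('a set \<Rightarrow> real) \<Rightarrow> bool" where
  "weakly_submodular \<gamma> \<beta> X f \<longleftrightarrow>
     (\<forall>A B. A \<subseteq> B \<longrightarrow> B \<subseteq> X \<longrightarrow>
        \<gamma> * (f B - f A) \<le> (\<Sum>e\<in>B - A. marginal f e A) \<and>
        \<beta> * (f B - f A) \<ge> (\<Sum>e\<in>B - A. marginal f e (B - {e})))"

text \<open>The indices are integers because the potential uses \<open>|S| - 1\<close> and \<open>|B| - 1\<close>,
  which may be \<open>-1\<close>. The value for \<open>0 \<le> a < b\<close> is irrelevant.\<close>

definition m_coeff :: "real \<Rightarrow> int \<Rightarrow> int \<Rightarrow> real" where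
  "m_coeff \<phi> a b =
     (if a < 0 \<or> b < 0 then 0
      else integral {0..1}
        (\<lambda>p. \<phi> * exp (\<phi> * p) / (exp \<phi> - 1) * p ^ nat b * (1 - p) ^ nat (a - b)))"

definition potential :: "real \<Rightarrow> ('a set \<Rightarrow> real) \<Rightarrow> 'a set \<Rightarrow> real" where
  "potential \<phi> f S =
     (\<Sum>B\<in>Pow S. m_coeff \<phi> (int (card S) - 1) (int (card B) - 1) * f B)"

locale matroid =
  fixes X :: "'a set" and \<I> :: "'a set set"
  assumes finite_ground: "finite X"
    and indep_subset_ground: "S \<in> \<I> \<Longrightarrow> S \<subseteq> X"
    and indep_empty: "{} \<in> \<I>"
    and indep_hereditary: "T \<in> \<I> \<Longrightarrow> S \<subseteq> T \<Longrightarrow> S \<in> \<I>"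
    and indep_augment:
      "S \<in> \<I> \<Longrightarrow> T \<in> \<I> \<Longrightarrow> card S < card T \<Longrightarrow> \<exists>e\<in>T - S. S \<union> {e} \<in> \<I>"

definition matroid_base :: "'a set set \<Rightarrow> 'a set \<Rightarrow> bool" where
  "matroid_base \<I> S \<longleftrightarrow> S \<in> \<I> \<and> (\<forall>T\<in>\<I>. S \<subseteq> T \<longrightarrow> T = S)"

text \<open>\<open>A = {a 1, \<dots>, a |A|}\<close> and \<open>U = {u 1, \<dots>, u |A|}\<close> are enumerated so that every
  \<open>A - {a i} \<union> {u i}\<close> is independent. As in the base exchange property (Brualdi's bijection
  between two bases), the elements of \<open>A \<inter> U\<close> are matched to themselves, i.e. \<open>u i\<close> is
  never an element of \<open>A - {a i}\<close>. This condition cannot be dropped: for \<open>A = U = {x, y}\<close> with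
  \<open>a = (x, y)\<close>, \<open>u = (y, x)\<close> all sets \<open>A - {a i} \<union> {u i}\<close> are independent without being
  bases, and the local-search inequality fails for \<open>f = card\<close>.\<close>

definition exchange_indexing ::
    "'a set set \<Rightarrow> 'a set \<Rightarrow> 'a set \<Rightarrow> (nat \<Rightarrow> 'a) \<Rightarrow> (nat \<Rightarrow> 'a) \<Rightarrow> bool" where
  "exchange_indexing \<I> A U a u \<longleftrightarrow>
     bij_betw a {1..card A} A \<and> bij_betw u {1..card A} U \<and>
     (\<forall>i\<in>{1..card A}. (A - {a i}) \<union> {u i} \<in> \<I>) \<and>
     (\<forall>i\<in>{1..card A}. u i \<in> A \<longrightarrow> u i = a i)"

end

theory Submission
  imports Defs
begin

text \<open>Let \<open>R\<close> be a random subset of \<open>A\<close> that contains every element independently with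
  probability \<open>p\<close>, put \<open>F p = E (f R)\<close> and \<open>w p = \<phi> * exp (\<phi> * p) / (exp \<phi> - 1)\<close>.
  The potential is the \<open>w\<close>-average of \<open>F p / p\<close>, so one exchange changes it by the \<open>w\<close>-average
  of \<open>E (f (R + a i) - f (R - a i + u i))\<close>. Summed over \<open>i\<close>, the gains of the \<open>a i\<close> over
  \<open>R - a i\<close> give \<open>F' p\<close>, while for every fixed \<open>R\<close> weak submodularity bounds the gains of the
  \<open>u i\<close> over \<open>R - a i\<close> from below by \<open>\<gamma>\<^sup>2 * f U - \<phi> * f R\<close>. Hence the sum of the exchanges is
  at most the integral of \<open>w * (F' + \<phi> * F) - \<gamma>\<^sup>2 * f U * w\<close>, and
  \<open>w * (F' + \<phi> * F)\<close> is the derivative of \<open>w * F\<close>.\<close>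

section \<open>Multilinear extension and its derivative along the diagonal\<close>

definition multilinear_ext :: "'a set \<Rightarrow> ('a set \<Rightarrow> real) \<Rightarrow> real \<Rightarrow> real" where
  "multilinear_ext S h p = (\<Sum>R\<in>Pow S. p ^ card R * (1 - p) ^ card (S - R) * h R)"

lemma sum_Pow_insert:
  assumes "finite S" "x \<notin> S"
  shows "(\<Sum>R\<in>Pow (insert x S). h R) = (\<Sum>R\<in>Pow S. h (insert x R)) + (\<Sum>R\<in>Pow S. h R :: real)"
proof -
  have "inj_on (insert x) (Pow S)"
    using assms(2) by (auto simp: inj_on_def)
  moreover have "Pow S \<inter> insert x ` Pow S = {}"
    using assms(2) by auto
  ultimately show ?thesis
    using assms(1) by (simp add: Pow_insert sum.union_disjoint sum.reindex)
qed

lemma multilinear_ext_empty [simp]: "multilinear_ext {} h p = h {}"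
  by (simp add: multilinear_ext_def)

text \<open>Conditioning on whether \<open>x\<close> is drawn; this recursion drives the later
  inductions on \<open>S\<close>.\<close>

lemma multilinear_ext_insert:
  assumes "finite S" "x \<notin> S"
  shows "multilinear_ext (insert x S) h p =
    p * multilinear_ext S (\<lambda>R. h (insert x R)) p + (1 - p) * multilinear_ext S h p"
proof -
  have "card (insert x R) = Suc (card R)" "insert x S - insert x R = S - R"
       "card (insert x S - R) = Suc (card (S - R))" if "R \<in> Pow S" for R
  proof -
    show "card (insert x R) = Suc (card R)"
      using that assms finite_subset by (subst card_insert_disjoint) auto
    show "insert x S - insert x R = S - R"
      using assms by auto
    have "insert x S - R = insert x (S - R)"
      using that assms by auto
    then show "card (insert x S - R) = Suc (card (S - R))"
      using assms by simp
  qed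
  then show ?thesis
    unfolding multilinear_ext_def sum_Pow_insert[OF assms] sum_distrib_left
    by (intro arg_cong2[where f = "(+)"] sum.cong) (auto simp: mult_ac)
qed

lemma multilinear_ext_cong:
  "(\<And>R. R \<subseteq> S \<Longrightarrow> h R = k R) \<Longrightarrow> multilinear_ext S h p = multilinear_ext S k p"
  unfolding multilinear_ext_def by (auto intro!: sum.cong)

lemma multilinear_ext_diff:
  "multilinear_ext S (\<lambda>R. h R - k R) p = multilinear_ext S h p - multilinear_ext S k p"
  unfolding multilinear_ext_def by (simp add: sum_subtractf algebra_simps)

lemma multilinear_ext_cmult:
  "multilinear_ext S (\<lambda>R. c * h R) p = c * multilinear_ext S h p"
  unfolding multilinear_ext_def by (simp add: sum_distrib_left mult_ac)

lemma multilinear_ext_sum: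
  "multilinear_ext S (\<lambda>R. \<Sum>i\<in>I. h i R) p = (\<Sum>i\<in>I. multilinear_ext S (h i) p)"
  unfolding multilinear_ext_def sum_distrib_left by (rule sum.swap)

lemma multilinear_ext_const:
  "finite S \<Longrightarrow> multilinear_ext S (\<lambda>_. c) p = c"
  by (induction S rule: finite_induct) (simp_all add: multilinear_ext_insert algebra_simps)

lemma multilinear_ext_mono:
  assumes "0 \<le> p" "p \<le> 1" "\<And>R. R \<subseteq> S \<Longrightarrow> h R \<le> k R"
  shows "multilinear_ext S h p \<le> multilinear_ext S k p"
  unfolding multilinear_ext_def using assms by (auto intro!: sum_mono mult_left_mono)

text \<open>Both outcomes for \<open>x\<close> give the same expectation, and their weights
  \<open>p\<close> and \<open>1 - p\<close> add up to 1.\<close>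

lemma multilinear_ext_remove_irrelevant:
  assumes "finite S" "x \<in> S" "\<And>R. R \<subseteq> S - {x} \<Longrightarrow> h (insert x R) = h R"
  shows "multilinear_ext S h p = multilinear_ext (S - {x}) h p"
proof -
  have "multilinear_ext S h p = multilinear_ext (insert x (S - {x})) h p"
    using assms(2) by (simp add: insert_absorb)
  also have "\<dots> = p * multilinear_ext (S - {x}) (\<lambda>R. h (insert x R)) p
      + (1 - p) * multilinear_ext (S - {x}) h p"
    using assms(1) by (subst multilinear_ext_insert) auto
  also have "multilinear_ext (S - {x}) (\<lambda>R. h (insert x R)) p = multilinear_ext (S - {x}) h p"
    using assms(3) by (rule multilinear_ext_cong)
  finally show ?thesis
    by (simp add: algebra_simps)
qed

text \<open>Give every element its own probability: the expectation is affine in that of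
  \<open>x\<close>, with slope the expected gain of \<open>x\<close> over \<open>R - {x}\<close>.
  With all probabilities equal to \<open>p\<close>, the chain rule adds these slopes. The induction
  needs only the product rule.\<close>

lemma has_derivative_multilinear_ext:
  assumes "finite S"
  shows "(multilinear_ext S h has_real_derivative
    (\<Sum>x\<in>S. multilinear_ext S (\<lambda>R. h (insert x R) - h (R - {x})) p)) (at p within T)"
  using assms
proof (induction S arbitrary: h rule: finite_induct)
  case empty
  have "multilinear_ext {} h = (\<lambda>_. h {})"
    by (simp add: fun_eq_iff)
  then show ?case
    by simp
next
  case (insert y S)
  let ?M = "multilinear_ext S"
  let ?hy = "\<lambda>R. h (insert y R)"
  let ?D = "\<lambda>h x R. h (insert x R) - h (R - {x})"
  have eq: "multilinear_ext (insert y S) h = (\<lambda>p. p * ?M ?hy p + (1 - p) * ?M h p)"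
    using insert.hyps by (simp add: fun_eq_iff multilinear_ext_insert)
  have deriv: "(multilinear_ext (insert y S) h has_real_derivative
      (?M ?hy p + p * (\<Sum>x\<in>S. ?M (?D ?hy x) p)) +
      (- ?M h p + (1 - p) * (\<Sum>x\<in>S. ?M (?D h x) p))) (at p within T)"
    unfolding eq by (auto intro!: derivative_eq_intros insert.IH)
  have old: "multilinear_ext (insert y S) (?D h x) p =
      p * ?M (?D ?hy x) p + (1 - p) * ?M (?D h x) p" if "x \<in> S" for x
  proof -
    have "insert y (R - {x}) = insert y R - {x}" for R
      using that insert.hyps by auto
    then show ?thesis
      using insert.hyps by (simp add: multilinear_ext_insert insert_commute)
  qed
  have new: "multilinear_ext (insert y S) (?D h y) p = ?M ?hy p - ?M h p"
  proof -
    have "multilinear_ext (insert y S) (?D h y) p = ?M (?D h y) p"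
      using insert.hyps multilinear_ext_remove_irrelevant[of "insert y S" y "?D h y" p] by simp
    also have "\<dots> = ?M (\<lambda>R. ?hy R - h R) p"
    proof (rule multilinear_ext_cong)
      fix R
      assume "R \<subseteq> S"
      then have "R - {y} = R"
        using insert.hyps by auto
      then show "?D h y R = ?hy R - h R"
        by simp
    qed
    finally show ?thesis
      by (simp add: multilinear_ext_diff)
  qed
  have "(\<Sum>x\<in>insert y S. multilinear_ext (insert y S) (?D h x) p) =
      (?M ?hy p - ?M h p) + (\<Sum>x\<in>S. p * ?M (?D ?hy x) p + (1 - p) * ?M (?D h x) p)"
    unfolding sum.insert[OF insert.hyps] new by (intro arg_cong2[where f = "(+)"] sum.cong refl old)
  also have "\<dots> = (?M ?hy p + p * (\<Sum>x\<in>S. ?M (?D ?hy x) p)) +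
      (- ?M h p + (1 - p) * (\<Sum>x\<in>S. ?M (?D h x) p))"
    by (simp add: sum.distrib sum_distrib_left)
  finally show ?case
    using deriv by (simp only:)
qed

section \<open>The potential as an integral against the exponential density\<close>

abbreviation exp_density :: "real \<Rightarrow> real \<Rightarrow> real" where
  "exp_density \<phi> p \<equiv> \<phi> * exp (\<phi> * p) / (exp \<phi> - 1)"

text \<open>If \<open>f {} = 0\<close>, then \<open>p * reduced_ext S f p = multilinear_ext S f p\<close>.\<close>

definition reduced_ext :: "'a set \<Rightarrow> ('a set \<Rightarrow> real) \<Rightarrow> real \<Rightarrow> real" where
  "reduced_ext S f p = (\<Sum>B\<in>Pow S. if B = {} then 0 else
      p ^ (card B - 1) * (1 - p) ^ card (S - B) * f B)"

lemma potential_has_integral: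
  assumes "finite S"
  shows "((\<lambda>p. exp_density \<phi> p * reduced_ext S f p) has_integral potential \<phi> f S) {0..1}"
proof -
  have "((\<lambda>p. exp_density \<phi> p * (if B = {} then 0 else
          p ^ (card B - 1) * (1 - p) ^ card (S - B) * f B)) has_integral
        m_coeff \<phi> (int (card S) - 1) (int (card B) - 1) * f B) {0..1}" if "B \<in> Pow S" for B
  proof (cases "B = {}")
    \<comment> \<open>The integer index \<open>card {} - 1\<close> is \<open>-1\<close>, where
      \<open>m_coeff\<close> is 0 by convention.\<close>
    case True
    then show ?thesis
      by (simp add: m_coeff_def)
  next
    case False
    let ?w = "\<lambda>p. exp_density \<phi> p * p ^ (card B - 1) * (1 - p) ^ card (S - B)"
    have fin: "finite B"
      using that assms finite_subset by auto
    have pos: "card B > 0" "card B \<le> card S"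
      using False fin that assms by (auto simp: card_gt_0_iff intro: card_mono)
    have "nat (int (card B) - 1) = card B - 1"
      by simp
    moreover have "nat (int (card S) - 1 - (int (card B) - 1)) = card (S - B)"
      using that fin by (simp add: card_Diff_subset nat_diff_distrib)
    ultimately have "m_coeff \<phi> (int (card S) - 1) (int (card B) - 1) = integral {0..1} ?w"
      using pos unfolding m_coeff_def by simp
    moreover have "?w integrable_on {0..1}"
      unfolding divide_inverse by (intro integrable_continuous_real continuous_intros)
    ultimately have "(?w has_integral m_coeff \<phi> (int (card S) - 1) (int (card B) - 1)) {0..1}"
      by (simp only: integrable_integral)
    from has_integral_mult_left[OF this, of "f B"] show ?thesis
      using False by (simp add: mult_ac)
  qed
  then show ?thesis
    unfolding potential_def reduced_ext_def sum_distrib_left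
    using assms by (intro has_integral_sum) auto
qed

text \<open>For sets containing \<open>x\<close>, the factor \<open>p\<close> contributed by
  \<open>x\<close> is the one missing in \<open>reduced_ext\<close>, so a full expectation over
  \<open>S\<close> remains.\<close>

lemma reduced_ext_insert:
  assumes "finite S" "x \<notin> S"
  shows "reduced_ext (insert x S) f p =
    multilinear_ext S (\<lambda>R. f (insert x R)) p + (1 - p) * reduced_ext S f p"
proof -
  have "card (insert x R) - 1 = card R" "insert x S - insert x R = S - R"
       "card (insert x S - R) = Suc (card (S - R))" if "R \<in> Pow S" for R
  proof -
    show "card (insert x R) - 1 = card R"
      using that assms finite_subset by (subst card_insert_disjoint) auto
    show "insert x S - insert x R = S - R"
      using assms by auto
    have "insert x S - R = insert x (S - R)"
      using that assms by auto
    then show "card (insert x S - R) = Suc (card (S - R))"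
      using assms by simp
  qed
  then show ?thesis
    unfolding multilinear_ext_def reduced_ext_def sum_Pow_insert[OF assms] sum_distrib_left
    by (intro arg_cong2[where f = "(+)"] sum.cong) (auto simp: mult_ac)
qed

text \<open>Both sets arise from \<open>A - {x}\<close> by adding one new element, so the terms with
  \<open>1 - p\<close> in \<open>reduced_ext_insert\<close> cancel.\<close>

lemma potential_exchange_has_integral:
  assumes "finite A" "x \<in> A" "y \<in> A \<Longrightarrow> y = x"
  shows "((\<lambda>p. exp_density \<phi> p *
      multilinear_ext A (\<lambda>R. f (insert x R) - f (insert y (R - {x}))) p)
    has_integral potential \<phi> f A - potential \<phi> f ((A - {x}) \<union> {y})) {0..1}"
proof -
  let ?A' = "A - {x}"
  let ?h = "\<lambda>R. f (insert x R) - f (insert y (R - {x}))"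
  have "reduced_ext A f p - reduced_ext (?A' \<union> {y}) f p = multilinear_ext A ?h p" for p
  proof -
    have "A = insert x ?A'"
      using assms by auto
    then have "reduced_ext A f p - reduced_ext (?A' \<union> {y}) f p =
        reduced_ext (insert x ?A') f p - reduced_ext (insert y ?A') f p"
      by simp
    also have "\<dots> = multilinear_ext ?A' (\<lambda>R. f (insert x R) - f (insert y R)) p"
      using assms by (subst (1 2) reduced_ext_insert) (auto simp: multilinear_ext_diff)
    also have "\<dots> = multilinear_ext ?A' ?h p"
    proof (rule multilinear_ext_cong)
      fix R
      assume "R \<subseteq> ?A'"
      then have "R - {x} = R"
        by auto
      then show "f (insert x R) - f (insert y R) = ?h R"
        by simp
    qed
    \<comment> \<open>Restoring \<open>x\<close> lets all exchanges share the same random subset of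
      \<open>A\<close>, so that they can be summed for each fixed \<open>R\<close>.\<close>
    also have "\<dots> = multilinear_ext A ?h p"
      using assms multilinear_ext_remove_irrelevant[of A x ?h p] by simp
    finally show ?thesis .
  qed
  moreover have "((\<lambda>p. exp_density \<phi> p * reduced_ext A f p
        - exp_density \<phi> p * reduced_ext (?A' \<union> {y}) f p)
      has_integral potential \<phi> f A - potential \<phi> f (?A' \<union> {y})) {0..1}"
    using assms(1) by (intro has_integral_diff potential_has_integral) auto
  ultimately show ?thesis
    by (simp only: right_diff_distrib[symmetric])
qed

lemma exp_density_has_derivative:
  "(exp_density \<phi> has_real_derivative \<phi> * exp_density \<phi> p) (at p within T)"
proof -
  have "((\<lambda>p. exp (\<phi> * p)) has_real_derivative exp (\<phi> * p) * \<phi>) (at p within T)"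
    by (auto intro!: derivative_eq_intros)
  from DERIV_cmult[OF this, of "\<phi> / (exp \<phi> - 1)"] show ?thesis
    by (simp add: mult_ac)
qed

lemma exp_density_has_integral:
  assumes "\<phi> > 0"
  shows "(exp_density \<phi> has_integral 1) {0..1}"
proof -
  have "((\<lambda>p. exp_density \<phi> p / \<phi>) has_vector_derivative exp_density \<phi> p) (at p within {0..1})" for p
    using DERIV_cdivide[OF exp_density_has_derivative[of \<phi> p "{0..1}"], of \<phi>] assms
    by (simp add: has_real_derivative_iff_has_vector_derivative)
  then have "(exp_density \<phi> has_integral exp_density \<phi> 1 / \<phi> - exp_density \<phi> 0 / \<phi>) {0..1}"
    by (intro fundamental_theorem_of_calculus) auto
  moreover have "exp_density \<phi> 1 / \<phi> - exp_density \<phi> 0 / \<phi> = 1"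
    using assms by (simp add: diff_divide_distrib[symmetric])
  ultimately show ?thesis
    by simp
qed

section \<open>The bound from weak submodularity for a fixed subset\<close>

text \<open>Moving the base of the gain of \<open>u i\<close> from \<open>R - {a i}\<close> to
  \<open>R\<close> costs a factor \<gamma> and a loss in \<open>a i\<close>. Comparing the gains
  over \<open>R\<close> with \<open>f U\<close> costs a second \<gamma>, and the upper inequality
  bounds the total loss by \<open>\<beta> * f R\<close>.\<close>

lemma sum_exchange_marginals_ge:
  assumes "finite X" "monotone_setfun X f" "normalized_setfun f"
    and ws: "weakly_submodular \<gamma> \<beta> X f" and "0 < \<gamma>" "\<gamma> \<le> 1"
    and A: "A \<subseteq> X" "bij_betw a I A" and U: "U \<subseteq> X" "bij_betw u I U"
    and fix_common: "\<And>i. i \<in> I \<Longrightarrow> u i \<in> A \<Longrightarrow> u i = a i"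
    and R: "R \<subseteq> A"
  shows "(\<Sum>i\<in>I. f (insert (u i) (R - {a i})) - f (R - {a i}))
    \<ge> \<gamma>\<^sup>2 * f U - (\<gamma>\<^sup>2 + \<beta> * (1 - \<gamma>)) * f R"
proof -
  have mono: "f S \<le> f T" if "S \<subseteq> T" "T \<subseteq> X" for S T
    using assms(2) that by (auto simp: monotone_setfun_def)
  have lower: "\<gamma> * (f T - f S) \<le> (\<Sum>e\<in>T - S. f (insert e S) - f S)"
    if "S \<subseteq> T" "T \<subseteq> X" for S T
    using ws that by (auto simp: weakly_submodular_def marginal_def)
  have upper: "(\<Sum>e\<in>T - S. f (insert e (T - {e})) - f (T - {e})) \<le> \<beta> * (f T - f S)"
    if "S \<subseteq> T" "T \<subseteq> X" for S T
    using ws that by (auto simp: weakly_submodular_def marginal_def)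
  have aA: "a i \<in> A" and uU: "u i \<in> U" if "i \<in> I" for i
    using A(2) U(2) that by (auto simp: bij_betw_def)
  let ?\<delta> = "\<lambda>x. f R - f (R - {x})"
  have single: "f (insert (u i) (R - {a i})) - f (R - {a i})
      \<ge> \<gamma> * (f (insert (u i) R) - f R) - (1 - \<gamma>) * ?\<delta> (a i)" if i: "i \<in> I" for i
  proof -
    have ux: "insert (u i) R \<subseteq> X"
      using uU[OF i] U(1) A(1) R by auto
    have gain: "f (insert (u i) R) - f R \<ge> 0" "?\<delta> (a i) \<ge> 0"
      using mono[of R "insert (u i) R"] mono[of "R - {a i}" R] ux by auto
    \<comment> \<open>\<open>fix_common\<close> keeps \<open>u i\<close> out of
      \<open>R - {a i}\<close>: if \<open>a i\<close> lies in \<open>R\<close>, the exchange is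
      trivial or \<open>u i\<close> is new.\<close>
    consider "a i \<notin> R" | "a i \<in> R" "u i = a i" | "a i \<in> R" "u i \<notin> A"
      using fix_common[OF i] by blast
    then show ?thesis
    proof cases
      case 1
      then have "R - {a i} = R"
        by auto
      moreover have "\<gamma> * (f (insert (u i) R) - f R) \<le> 1 * (f (insert (u i) R) - f R)"
        using gain \<open>\<gamma> \<le> 1\<close> by (intro mult_right_mono) auto
      ultimately show ?thesis
        by simp
    next
      case 2
      have "(1 - \<gamma>) * ?\<delta> (a i) \<ge> 0"
        using gain \<open>\<gamma> \<le> 1\<close> by simp
      then show ?thesis
        using 2 gain by (simp add: insert_absorb)
    next
      case 3
      have ne: "a i \<noteq> u i"
        using 3 R by auto
      have "insert (u i) R - (R - {a i}) = {a i, u i}"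
        using 3 R by auto
      \<comment> \<open>The lower inequality across the two elements \<open>a i\<close> and
        \<open>u i\<close>; splitting its left side at \<open>f R\<close> gives the claim.\<close>
      then have "\<gamma> * (f (insert (u i) R) - f (R - {a i}))
          \<le> (f R - f (R - {a i})) + (f (insert (u i) (R - {a i})) - f (R - {a i}))"
        using lower[of "R - {a i}" "insert (u i) R"] ux ne 3(1)
        by (auto simp: insert_absorb)
      then show ?thesis
        by (simp add: algebra_simps)
    qed
  qed
  have RX: "R \<subseteq> X" and URX: "U \<union> R \<subseteq> X"
    using R A(1) U(1) by auto
  have finA: "finite A" and finU: "finite U"
    using A U assms(1) finite_subset by auto
  \<comment> \<open>Losses vanish outside \<open>R\<close>; inside they are the marginals in the
    upper inequality for \<open>{}\<close> and \<open>R\<close>.\<close>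
  have "(\<Sum>i\<in>I. ?\<delta> (a i)) = (\<Sum>x\<in>A. ?\<delta> x)"
    by (rule sum.reindex_bij_betw[OF A(2)])
  also have "\<dots> = (\<Sum>x\<in>R. ?\<delta> x)"
    using R finA by (intro sum.mono_neutral_right) auto
  also have "\<dots> = (\<Sum>x\<in>R - {}. f (insert x (R - {x})) - f (R - {x}))"
    by (intro sum.cong) (auto simp: insert_absorb)
  also have "\<dots> \<le> \<beta> * f R"
    using upper[of "{}" R] RX assms(3) by (simp add: normalized_setfun_def)
  finally have loss: "(\<Sum>i\<in>I. ?\<delta> (a i)) \<le> \<beta> * f R" .
  have "\<gamma> * (f U - f R) \<le> \<gamma> * (f (U \<union> R) - f R)"
    using mono[of U "U \<union> R"] URX \<open>0 < \<gamma>\<close> by (intro mult_left_mono) auto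
  also have "\<dots> \<le> (\<Sum>x\<in>U \<union> R - R. f (insert x R) - f R)"
    using lower[of R "U \<union> R"] URX by simp
  also have "\<dots> = (\<Sum>x\<in>U. f (insert x R) - f R)"
    using finU by (intro sum.mono_neutral_left) (auto simp: insert_absorb)
  also have "\<dots> = (\<Sum>i\<in>I. f (insert (u i) R) - f R)"
    by (rule sum.reindex_bij_betw[OF U(2), symmetric])
  finally have gain: "\<gamma> * (f U - f R) \<le> (\<Sum>i\<in>I. f (insert (u i) R) - f R)" .
  \<comment> \<open>The two parts of \<phi> separate here: \<open>\<gamma>\<^sup>2\<close> belongs
    to the gains, \<open>\<beta> * (1 - \<gamma>)\<close> to the losses.\<close>
  have "\<gamma>\<^sup>2 * f U - (\<gamma>\<^sup>2 + \<beta> * (1 - \<gamma>)) * f R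
      = \<gamma> * (\<gamma> * (f U - f R)) - (1 - \<gamma>) * (\<beta> * f R)"
    by (simp add: algebra_simps power2_eq_square)
  also have "\<dots> \<le> \<gamma> * (\<Sum>i\<in>I. f (insert (u i) R) - f R) - (1 - \<gamma>) * (\<Sum>i\<in>I. ?\<delta> (a i))"
    using gain loss assms by (intro diff_mono mult_left_mono) auto
  also have "\<dots> = (\<Sum>i\<in>I. \<gamma> * (f (insert (u i) R) - f R) - (1 - \<gamma>) * ?\<delta> (a i))"
    unfolding sum_distrib_left sum_subtractf[symmetric] ..
  also have "\<dots> \<le> (\<Sum>i\<in>I. f (insert (u i) (R - {a i})) - f (R - {a i}))"
    by (intro sum_mono single)
  finally show ?thesis .
qed

section \<open>Integration of the bound over the sampling probability\<close>

theorem theorem3: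
  fixes X :: "'a set" and \<I> :: "'a set set" and f :: "'a set \<Rightarrow> real"
    and \<gamma> \<beta> \<phi> :: real and A U :: "'a set" and a u :: "nat \<Rightarrow> 'a"
  assumes "\<And>S. S \<subseteq> X \<Longrightarrow> 0 \<le> f S"
    and "monotone_setfun X f"
    and "normalized_setfun f"
    and "weakly_submodular \<gamma> \<beta> X f"
    and "0 < \<gamma>" and "\<gamma> \<le> 1" and "1 \<le> \<beta>"
    and "\<phi> = \<gamma>\<^sup>2 + \<beta> * (1 - \<gamma>)"
    and "matroid X \<I>"
    and "matroid_base \<I> A" and "matroid_base \<I> U"
    and "exchange_indexing \<I> A U a u"
  shows "\<phi> * exp \<phi> / (exp \<phi> - 1) * f A
           \<ge> \<gamma>\<^sup>2 * f U
             + (\<Sum>i=1..card A. potential \<phi> f A - potential \<phi> f ((A - {a i}) \<union> {u i}))"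
proof -
  let ?I = "{1..card A}"
  let ?w = "exp_density \<phi>"
  let ?F = "multilinear_ext A f"
  let ?d = "\<lambda>i R. f (insert (a i) R) - f (insert (u i) (R - {a i}))"
  let ?D = "\<lambda>x R. f (insert x R) - f (R - {x})"
  let ?F' = "\<lambda>p. \<Sum>x\<in>A. multilinear_ext A (?D x) p"
  have AX: "A \<subseteq> X" and UX: "U \<subseteq> X" and finX: "finite X"
    using assms(9-11) by (auto simp: matroid_def matroid_base_def)
  have finA: "finite A"
    using AX finX finite_subset by auto
  have a: "bij_betw a ?I A" and u: "bij_betw u ?I U"
    and common: "\<And>i. i \<in> ?I \<Longrightarrow> u i \<in> A \<Longrightarrow> u i = a i"
    using assms(12) by (auto simp: exchange_indexing_def)
  have aA: "a i \<in> A" if "i \<in> ?I" for i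
    using a that by (auto simp: bij_betw_def)
  have "\<phi> > 0"
    unfolding assms(8) using assms(5-7) by (intro add_pos_nonneg) auto
  have "((\<lambda>p. \<Sum>i\<in>?I. ?w p * multilinear_ext A (?d i) p) has_integral
      (\<Sum>i\<in>?I. potential \<phi> f A - potential \<phi> f ((A - {a i}) \<union> {u i}))) {0..1}"
    using finA aA common by (intro has_integral_sum potential_exchange_has_integral) auto
  moreover have "((\<lambda>p. ?w p * (?F' p + \<phi> * ?F p) - \<gamma>\<^sup>2 * f U * ?w p) has_integral
      (?w 1 * ?F 1 - ?w 0 * ?F 0) - \<gamma>\<^sup>2 * f U * 1) {0..1}"
  proof (intro has_integral_diff has_integral_mult_right exp_density_has_integral \<open>\<phi> > 0\<close>
      fundamental_theorem_of_calculus)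
    \<comment> \<open>The rate of the density equals the coefficient of \<open>f R\<close> in
      \<open>sum_exchange_marginals_ge\<close>, so the product rule yields exactly the term
      \<open>\<phi> * ?F p\<close>.\<close>
    fix p :: real
    show "((\<lambda>p. ?w p * ?F p) has_vector_derivative ?w p * (?F' p + \<phi> * ?F p)) (at p within {0..1})"
      using DERIV_mult'[OF exp_density_has_derivative[of \<phi> p "{0..1}"]
          has_derivative_multilinear_ext[OF finA, of f p]]
      by (simp add: has_real_derivative_iff_has_vector_derivative algebra_simps)
  qed auto
  moreover have "(\<Sum>i\<in>?I. ?w p * multilinear_ext A (?d i) p)
      \<le> ?w p * (?F' p + \<phi> * ?F p) - \<gamma>\<^sup>2 * f U * ?w p" if p: "p \<in> {0..1}" for p
  proof -
    \<comment> \<open>Inserting \<open>f (R - {a i})\<close> splits each exchange into the gain of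
      \<open>a i\<close> minus the gain of \<open>u i\<close>.\<close>
    have "(\<Sum>i\<in>?I. ?d i R) \<le> (\<Sum>x\<in>A. ?D x R) - (\<gamma>\<^sup>2 * f U - \<phi> * f R)" if R: "R \<subseteq> A" for R
    proof -
      have "(\<Sum>i\<in>?I. f (insert (u i) (R - {a i})) - f (R - {a i})) \<ge> \<gamma>\<^sup>2 * f U - \<phi> * f R"
        unfolding assms(8)
        by (rule sum_exchange_marginals_ge[OF finX assms(2-6) AX a UX u common R])
      moreover have "(\<Sum>x\<in>A. ?D x R) = (\<Sum>i\<in>?I. ?D (a i) R)"
        by (rule sum.reindex_bij_betw[OF a, symmetric])
      ultimately show ?thesis
        by (simp add: sum_subtractf)
    qed
    then have "multilinear_ext A (\<lambda>R. \<Sum>i\<in>?I. ?d i R) p \<le>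
        multilinear_ext A (\<lambda>R. (\<Sum>x\<in>A. ?D x R) - (\<gamma>\<^sup>2 * f U - \<phi> * f R)) p"
      using p by (intro multilinear_ext_mono) auto
    then have "(\<Sum>i\<in>?I. multilinear_ext A (?d i) p) \<le> ?F' p - (\<gamma>\<^sup>2 * f U - \<phi> * ?F p)"
      using finA
      by (simp only: multilinear_ext_sum multilinear_ext_diff multilinear_ext_cmult
          multilinear_ext_const)
    then have "?w p * (\<Sum>i\<in>?I. multilinear_ext A (?d i) p)
        \<le> ?w p * (?F' p - (\<gamma>\<^sup>2 * f U - \<phi> * ?F p))"
      using \<open>\<phi> > 0\<close> by (intro mult_left_mono) auto
    then show ?thesis
      unfolding sum_distrib_left[symmetric] by (simp only: algebra_simps)
  qed
  ultimately have "(\<Sum>i\<in>?I. potential \<phi> f A - potential \<phi> f ((A - {a i}) \<union> {u i}))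
      \<le> (?w 1 * ?F 1 - ?w 0 * ?F 0) - \<gamma>\<^sup>2 * f U * 1"
    by (rule has_integral_le)
  moreover have "?F 1 = f A"
  proof -
    \<comment> \<open>Since \<open>0 ^ 0 = 1\<close>, exactly the term \<open>R = A\<close>
      survives; at \<open>p = 0\<close> it is \<open>R = {}\<close>.\<close>
    have "?F 1 = (\<Sum>R\<in>Pow A. if R = A then f A else 0)"
      unfolding multilinear_ext_def using finA
      by (intro sum.cong) (auto simp: power_0_left)
    then show ?thesis
      using finA by simp
  qed
  moreover have "?F 0 = f {}"
  proof -
    have "?F 0 = (\<Sum>R\<in>Pow A. if R = {} then f {} else 0)"
      unfolding multilinear_ext_def using finA finite_subset[OF _ finA]
      by (intro sum.cong) (auto simp: power_0_left)
    then show ?thesis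
      using finA by simp
  qed
  \<comment> \<open>\<open>?w 1\<close> is the constant of the claim, and the boundary term at 0
    vanishes because \<open>f {} = 0\<close>.\<close>
  ultimately show ?thesis
    using assms(3) by (simp add: normalized_setfun_def)
qed

end
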